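(* Let $G$ be a separable unimodular locally compact group and $(\pi,\mathcal{H}_\pi)$ a (unitary, strongly continuous) representation of $G$. Let $(T_i)_{i\in I} \subset \pi(G)'$ be a family spanning a weak-operator dense subspace of $\pi(G)'$, and let $(\eta_0,\psi_0)$ be an admissible pair for $\pi$. Then for every pair of bounded vectors $(\eta,\psi)$ in $\mathcal{H}_\pi$: $$(\eta,\psi) \text{ is admissible} \iff \forall i \in I:\ \langle T_i\eta,\psi\rangle = \langle T_i\eta_0,\psi_0\rangle.$$
   Context: "Separable" for a locally compact group means second countable. Inner products are linear in the first argument. $\pi(G)'$ is the commutant of $\pi(G)$ in the bounded operators on $\mathcal{H}_\pi$. Weak-operator density of the span means: for each $S \in \pi(G)'$ there is a net $(S_j)_{j\in J}$ in the linear span of $(T_i)_{i\in I}$ with $\langle S_j y,z\rangle \to \langle Sy,z\rangle$ for all $y,z \in \mathcal{H}_\pi$. A vector $\eta \in \mathcal{H}_\pi$ is called bounded if the coefficient operator $V_\eta : \mathcal{H}_\pi \to \mathrm{L}^2(G)$, $(V_\eta\varphi)(x) = \langle \varphi,\pi(x)\eta\rangle$, is a (well-defined) bounded map, where $\mathrm{L}^2(G)$ is taken with respect to Haar measure. A pair $(\eta,\psi)$ of bounded vectors is called admissible if $V_\eta^* V_\psi = \mathrm{Id}_{\mathcal{H}_\pi}$. *)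

theory Defs
  imports "HOL-Analysis.Analysis"
begin

section \<open>Complex Hilbert spaces\<close>

text \<open>The inner product \<open>cinner\<close> is linear in its first argument. The underlying real
  inner product is its real part, so that norm, metric and topology are those of
  \<^class>\<open>real_inner\<close>; positive definiteness of \<open>cinner\<close> then follows from that of \<^const>\<open>inner\<close>.\<close>

class complex_inner = real_inner +
  fixes scaleC :: "complex \<Rightarrow> 'a \<Rightarrow> 'a" (infixr "*\<^sub>C" 75)
    and cinner :: "'a \<Rightarrow> 'a \<Rightarrow> complex"
  assumes scaleC_add_right: "c *\<^sub>C (x + y) = c *\<^sub>C x + c *\<^sub>C y"
    and scaleC_add_left: "(c + d) *\<^sub>C x = c *\<^sub>C x + d *\<^sub>C x"
    and scaleC_scaleC: "c *\<^sub>C d *\<^sub>C x = (c * d) *\<^sub>C x"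
    and scaleC_of_real: "complex_of_real r *\<^sub>C x = r *\<^sub>R x"
    and cinner_add_left: "cinner (x + y) z = cinner x z + cinner y z"
    and cinner_scaleC_left: "cinner (c *\<^sub>C x) y = c * cinner x y"
    and cinner_commute: "cinner y x = cnj (cinner x y)"
    and Re_cinner: "Re (cinner x y) = inner x y"

class chilbert_space = complex_inner + complete_space

definition bounded_clinear :: "('a::complex_inner \<Rightarrow> 'b::complex_inner) \<Rightarrow> bool" where
  "bounded_clinear S \<longleftrightarrow> bounded_linear S \<and> (\<forall>c v. S (c *\<^sub>C v) = c *\<^sub>C S v)"

definition unitary :: "('a::complex_inner \<Rightarrow> 'a) \<Rightarrow> bool" where
  "unitary U \<longleftrightarrow> bounded_clinear U \<and> bij U \<and> (\<forall>v w. cinner (U v) (U w) = cinner v w)"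

definition op_span :: "('i \<Rightarrow> 'a \<Rightarrow> 'a::complex_inner) \<Rightarrow> 'i set \<Rightarrow> ('a \<Rightarrow> 'a) set" where
  "op_span T I = {\<lambda>v. \<Sum>i\<in>J. c i *\<^sub>C T i v | J c. finite J \<and> J \<subseteq> I}"

text \<open>Nets of operators are expressed, as usual in Isabelle/HOL, by proper filters.\<close>

definition wot_dense_in :: "('a \<Rightarrow> 'a::complex_inner) set \<Rightarrow> ('a \<Rightarrow> 'a) set \<Rightarrow> bool" where
  "wot_dense_in D A \<longleftrightarrow> D \<subseteq> A \<and>
     (\<forall>S\<in>A. \<exists>F. F \<noteq> bot \<and> (\<forall>\<^sub>F R in F. R \<in> D) \<and>
        (\<forall>y z. ((\<lambda>R. cinner (R y) z) \<longlongrightarrow> cinner (S y) z) F))"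

section \<open>Haar measure\<close>

text \<open>The class \<^class>\<open>group_add\<close> does not assume commutativity: groups are written additively
  only because the library's topological groups are, so \<open>x + y\<close>, \<open>0\<close> and \<open>- x\<close> are the product,
  the identity and the inverse of a possibly non-abelian group.\<close>

text \<open>Regularity is not required in the following definition, since it is automatic for Borel
  measures that are finite on compact sets in a second countable locally compact Hausdorff space.\<close>

definition left_haar_measure :: "'g::topological_group_add measure \<Rightarrow> bool" where
  "left_haar_measure \<mu> \<longleftrightarrow>
     sets \<mu> = sets borel \<and>
     emeasure \<mu> UNIV \<noteq> 0 \<and>
     (\<forall>K. compact K \<longrightarrow> emeasure \<mu> K < \<infinity>) \<and>
     (\<forall>A\<in>sets borel. \<forall>x. emeasure \<mu> ((\<lambda>y. x + y) ` A) = emeasure \<mu> A)"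

definition unimodular :: "'g::topological_group_add itself \<Rightarrow> bool" where
  "unimodular _ \<longleftrightarrow> (\<forall>\<mu>::'g measure. left_haar_measure \<mu> \<longrightarrow>
     (\<forall>A\<in>sets borel. \<forall>x. emeasure \<mu> ((\<lambda>y. y + x) ` A) = emeasure \<mu> A))"

section \<open>Square-integrable functions\<close>

text \<open>Elements of $L^2$ are handled through representatives; all notions below depend only on
  the classes of these functions modulo equality almost everywhere.\<close>

definition L2 :: "'g measure \<Rightarrow> ('g \<Rightarrow> complex) set" where
  "L2 \<mu> = {f \<in> borel_measurable \<mu>. integrable \<mu> (\<lambda>x. (cmod (f x))\<^sup>2)}"

definition L2_inner :: "'g measure \<Rightarrow> ('g \<Rightarrow> complex) \<Rightarrow> ('g \<Rightarrow> complex) \<Rightarrow> complex" where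
  "L2_inner \<mu> f g = (LINT x|\<mu>. f x * cnj (g x))"

definition L2_norm :: "'g measure \<Rightarrow> ('g \<Rightarrow> complex) \<Rightarrow> real" where
  "L2_norm \<mu> f = sqrt (LINT x|\<mu>. (cmod (f x))\<^sup>2)"

definition bounded_into_L2 :: "'g measure \<Rightarrow> ('a::complex_inner \<Rightarrow> 'g \<Rightarrow> complex) \<Rightarrow> bool" where
  "bounded_into_L2 \<mu> V \<longleftrightarrow>
     (\<forall>v. V v \<in> L2 \<mu>) \<and> (\<exists>C. \<forall>v. L2_norm \<mu> (V v) \<le> C * norm v)"

text \<open>The adjoint $V^* : L^2 \to H$ of a bounded linear map $V : H \to L^2$. On a Hilbert space
  $H$ the described vector exists and is unique for every $f \in L^2$, by the Riesz
  representation theorem.\<close>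

definition L2_adjoint ::
    "'g measure \<Rightarrow> ('a::complex_inner \<Rightarrow> 'g \<Rightarrow> complex) \<Rightarrow> ('g \<Rightarrow> complex) \<Rightarrow> 'a" where
  "L2_adjoint \<mu> V f = (THE v. \<forall>w. cinner v w = L2_inner \<mu> f (V w))"

section \<open>Representations, bounded vectors and admissible pairs\<close>

definition unitary_rep :: "('g::topological_group_add \<Rightarrow> 'a \<Rightarrow> 'a::complex_inner) \<Rightarrow> bool" where
  "unitary_rep \<pi> \<longleftrightarrow>
     (\<forall>x. unitary (\<pi> x)) \<and>
     \<pi> 0 = id \<and> (\<forall>x y. \<pi> (x + y) = \<pi> x \<circ> \<pi> y) \<and>
     (\<forall>v. continuous_on UNIV (\<lambda>x. \<pi> x v))"

definition commutant :: "('g \<Rightarrow> 'a \<Rightarrow> 'a::complex_inner) \<Rightarrow> ('a \<Rightarrow> 'a) set" where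
  "commutant \<pi> = {S. bounded_clinear S \<and> (\<forall>x. S \<circ> \<pi> x = \<pi> x \<circ> S)}"

definition coeff_op :: "('g \<Rightarrow> 'a \<Rightarrow> 'a::complex_inner) \<Rightarrow> 'a \<Rightarrow> 'a \<Rightarrow> 'g \<Rightarrow> complex" where
  "coeff_op \<pi> \<eta> \<phi> = (\<lambda>x. cinner \<phi> (\<pi> x \<eta>))"

definition bounded_vector ::
    "'g measure \<Rightarrow> ('g \<Rightarrow> 'a \<Rightarrow> 'a::complex_inner) \<Rightarrow> 'a \<Rightarrow> bool" where
  "bounded_vector \<mu> \<pi> \<eta> \<longleftrightarrow> bounded_into_L2 \<mu> (coeff_op \<pi> \<eta>)"

definition admissible ::
    "'g measure \<Rightarrow> ('g \<Rightarrow> 'a \<Rightarrow> 'a::complex_inner) \<Rightarrow> 'a \<Rightarrow> 'a \<Rightarrow> bool" where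
  "admissible \<mu> \<pi> \<eta> \<psi> \<longleftrightarrow>
     bounded_vector \<mu> \<pi> \<eta> \<and> bounded_vector \<mu> \<pi> \<psi> \<and>
     L2_adjoint \<mu> (coeff_op \<pi> \<eta>) \<circ> coeff_op \<pi> \<psi> = id"

end

theory Submission
  imports Defs
begin

text \<open>
  Write \<open>V\<^sub>\<eta>\<close> for the coefficient operator of \<open>\<eta>\<close>. On a unimodular group Haar measure is
  invariant under inversion (\<open>haar_inversion_invariant\<close>), and substituting the inverse in the integral
  gives the identity
  \<open>\<langle>V\<^sub>\<psi> u, V\<^sub>\<eta> v\<rangle> = \<langle>V\<^sub>v \<eta>, V\<^sub>u \<psi>\<rangle>\<close> (\<open>L2_inner_coeff_swap\<close>). If all the vectors are bounded
  it reads \<open>\<langle>V\<^sub>\<eta>\<^sup>* V\<^sub>\<psi> u, v\<rangle> = \<langle>S \<eta>, \<psi>\<rangle>\<close> with \<open>S = V\<^sub>u\<^sup>* V\<^sub>v\<close> in the commutant of \<open>\<pi>\<close>. So the operator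
  \<open>V\<^sub>\<eta>\<^sup>* V\<^sub>\<psi>\<close> is governed by the functional \<open>S \<mapsto> \<langle>S \<eta>, \<psi>\<rangle>\<close> on the commutant, and this functional is
  in turn determined by its values on the \<open>T i\<close>, by weak density (\<open>wot_dense_cinner_eq\<close>).

  If the functionals of \<open>(\<eta>, \<psi>)\<close> and \<open>(\<eta>\<^sub>0, \<psi>\<^sub>0)\<close> agree, the operators \<open>V\<^sub>\<eta>\<^sup>* V\<^sub>\<psi>\<close> and
  \<open>V\<^sub>\<eta>\<^sub>0\<^sup>* V\<^sub>\<psi>\<^sub>0 = Id\<close> have the same matrix coefficients between bounded vectors. The orbit of \<open>\<eta>\<^sub>0\<close>
  consists of bounded vectors and is total, so the operators are equal (\<open>admissibleI_commutant\<close>).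
  Conversely, if both pairs are admissible and \<open>T\<close> is in the commutant, then
  \<open>\<langle>T \<eta>, \<psi>\<rangle> = \<langle>V\<^sub>\<psi>\<^sub>0 T \<eta>, V\<^sub>\<eta>\<^sub>0 \<psi>\<rangle> = \<langle>V\<^sub>\<psi> \<eta>\<^sub>0, V\<^sub>\<eta> T\<^sup>* \<psi>\<^sub>0\<rangle> = \<langle>\<eta>\<^sub>0, T\<^sup>* \<psi>\<^sub>0\<rangle> = \<langle>T \<eta>\<^sub>0, \<psi>\<^sub>0\<rangle>\<close>
  (\<open>admissible_cinner_commutant\<close>).

  The operators \<open>V\<^sub>u\<^sup>* V\<^sub>v\<close> and the adjoints exist by the representation theorem
  for bounded sesquilinear forms (\<open>bounded_sesquilinear_operator\<close>).
\<close>

section \<open>Bounded sesquilinear forms on Hilbert spaces\<close>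

text \<open>The representing vector minimises the functional \<open>x \<mapsto> \<parallel>x\<parallel>\<^sup>2 - 2 f x\<close>. Minimising sequences
  are Cauchy by the parallelogram law, and the first variation at the minimum is the claim.\<close>

lemma riesz_real:
  fixes f :: "'a::{real_inner,complete_space} \<Rightarrow> real"
  assumes "bounded_linear f"
  shows "\<exists>z. \<forall>y. inner z y = f y"
proof -
  interpret f: bounded_linear f by fact
  define J where "J x = inner x x - 2 * f x" for x
  obtain K where K: "\<And>x. norm (f x) \<le> norm x * K" using f.bounded by blast
  have Jlow: "J x \<ge> - K\<^sup>2" for x
  proof -
    have "f x \<le> norm x * K" using K[of x] by simp
    moreover have "(norm x - K)\<^sup>2 \<ge> 0" by simp
    ultimately show ?thesis
      unfolding J_def by (simp add: power2_norm_eq_inner[symmetric] power2_diff)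
  qed
  define m where "m = Inf (range J)"
  have bdd: "bdd_below (range J)" using Jlow by (rule bdd_belowI2)
  have m: "m \<le> J x" for x unfolding m_def using bdd by (simp add: cInf_lower)
  have "\<exists>x. J x < m + 1 / real (Suc n)" for n
    using cInf_lessD[of "range J" "m + 1 / real (Suc n)"] by (auto simp: m_def)
  then obtain X where X: "\<And>n. J (X n) < m + 1 / real (Suc n)" by metis
  have par: "(norm (x - y))\<^sup>2 \<le> 2 * (J x - m) + 2 * (J y - m)" for x y
  proof -
    have "(norm (x - y))\<^sup>2 = 2 * J x + 2 * J y - 4 * J ((1/2) *\<^sub>R (x + y))"
      unfolding J_def power2_norm_eq_inner f.scaleR f.add
      by (simp add: inner_diff inner_add algebra_simps inner_commute)
    then show ?thesis using m[of "(1/2) *\<^sub>R (x + y)"] by simp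
  qed
  have "Cauchy X"
  proof (rule metric_CauchyI)
    fix e :: real assume e: "e > 0"
    have "e\<^sup>2 / 4 > 0" using e by simp
    then obtain N where N: "1 / real (Suc N) < e\<^sup>2 / 4" by (rule nat_approx_posE)
    have small: "J (X n) - m < e\<^sup>2 / 4" if "n \<ge> N" for n
    proof -
      have "1 / real (Suc n) \<le> 1 / real (Suc N)" using that by (intro divide_left_mono) auto
      then show ?thesis using X[of n] N by linarith
    qed
    have "dist (X p) (X q) < e" if "p \<ge> N" "q \<ge> N" for p q
    proof -
      have "(norm (X p - X q))\<^sup>2 < e\<^sup>2"
        using par[of "X p" "X q"] small[OF that(1)] small[OF that(2)] by (simp add: field_simps)
      then show ?thesis using e by (simp add: dist_norm power_less_imp_less_base)
    qed
    then show "\<exists>M. \<forall>p\<ge>M. \<forall>q\<ge>M. dist (X p) (X q) < e" by blast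
  qed
  then obtain z where z: "X \<longlonglongrightarrow> z" using Cauchy_convergent convergent_def by blast
  have "(\<lambda>n. J (X n)) \<longlonglongrightarrow> J z"
    unfolding J_def by (intro tendsto_intros z f.tendsto)
  moreover have "(\<lambda>n. m + 1 / real (Suc n)) \<longlonglongrightarrow> m + 0"
    by (intro tendsto_add tendsto_const LIMSEQ_Suc[OF lim_1_over_n])
  ultimately have "J z \<le> m + 0"
    by (rule LIMSEQ_le) (use X less_imp_le in blast)
  then have min: "J z \<le> J x" for x using m[of x] by simp
  have "inner z y = f y" for y
  proof (cases "y = 0")
    case True then show ?thesis by (simp add: f.zero)
  next
    case False
    define d where "d = inner z y - f y"
    \<comment> \<open>the step along \<open>y\<close> that minimises the quadratic \<open>2 t d + t\<^sup>2 \<parallel>y\<parallel>\<^sup>2\<close> in \<open>t\<close>\<close>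
    define t where "t = - d / inner y y"
    have pos: "inner y y > 0" using False by simp
    have "J (z + t *\<^sub>R y) = J z + 2 * t * d + t * (t * inner y y)"
      unfolding J_def d_def f.scaleR f.add
      by (simp add: inner_add algebra_simps inner_commute)
    then have "0 \<le> 2 * t * d + t * (t * inner y y)" using min[of "z + t *\<^sub>R y"] by simp
    also have "\<dots> = - (d * d / inner y y)" using pos by (simp add: t_def)
    finally have "d * d / inner y y \<le> 0" by simp
    then have "d * d \<le> 0" using pos by (simp add: divide_le_0_iff)
    then have "d = 0" using mult_le_0_iff[of d d] by auto
    then show ?thesis by (simp add: d_def)
  qed
  then show ?thesis by blast
qed

lemma cinner_add_right: "cinner x (y + z) = cinner x y + cinner x (z::'a::complex_inner)"
  by (metis cinner_add_left cinner_commute complex_cnj_add)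

lemma cinner_scaleC_right: "cinner x (c *\<^sub>C y) = cnj c * cinner x (y::'a::complex_inner)"
  by (metis cinner_scaleC_left cinner_commute complex_cnj_mult)

lemma cinner_zero_left [simp]: "cinner 0 (y::'a::complex_inner) = 0"
  using cinner_add_left[of 0 0 y] by simp

lemma cinner_diff_left: "cinner (x - y) z = cinner x z - cinner y (z::'a::complex_inner)"
  using cinner_add_left[of "x - y" y z] by simp

lemma cinner_sum_left: "cinner (sum f A) (z::'a::complex_inner) = (\<Sum>i\<in>A. cinner (f i) z)"
  by (induction A rule: infinite_finite_induct) (auto simp: cinner_add_left)

lemma cinner_extensionality:
  fixes x y :: "'a::complex_inner"
  assumes "\<And>w. cinner x w = cinner y w"
  shows "x = y"
proof -
  have "cinner (x - y) (x - y) = 0" using assms by (simp add: cinner_diff_left)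
  then have "inner (x - y) (x - y) = 0" by (metis Re_cinner zero_complex.sel(1))
  then show ?thesis by simp
qed

lemma cmod_cinner_le:
  fixes x y :: "'a::complex_inner"
  shows "cmod (cinner x y) \<le> norm x * norm y"
proof (cases "cinner x y = 0")
  case False
  \<comment> \<open>the phase that makes \<open>cinner x y\<close> real, so that the real inequality applies\<close>
  define c where "c = cnj (cinner x y) / cmod (cinner x y)"
  have c: "cmod c = 1" using False by (simp add: c_def norm_divide)
  have e: "c * cinner x y = cmod (cinner x y)"
    using False by (simp add: c_def complex_norm_square[symmetric] power2_eq_square
        mult.commute[of "cnj _"])
  have "(norm (c *\<^sub>C x))\<^sup>2 = Re (cinner (c *\<^sub>C x) (c *\<^sub>C x))"
    by (simp add: Re_cinner power2_norm_eq_inner)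
  also have "\<dots> = Re ((c * cnj c) * cinner x x)"
    by (simp only: cinner_scaleC_left cinner_scaleC_right mult_ac)
  also have "\<dots> = (norm x)\<^sup>2"
    by (subst complex_norm_square[symmetric]) (simp add: c Re_cinner power2_norm_eq_inner)
  finally have n: "norm (c *\<^sub>C x) = norm x" by simp
  have "cmod (cinner x y) = inner (c *\<^sub>C x) y"
    by (metis Re_cinner Re_complex_of_real cinner_scaleC_left e)
  also have "\<dots> \<le> norm x * norm y" using norm_cauchy_schwarz[of "c *\<^sub>C x" y] n by simp
  finally show ?thesis .
qed simp

definition bounded_sesquilinear ::
    "('a::complex_inner \<Rightarrow> 'b::complex_inner \<Rightarrow> complex) \<Rightarrow> bool" where
  "bounded_sesquilinear b \<longleftrightarrow>
     (\<forall>x y z. b (x + y) z = b x z + b y z) \<and> (\<forall>c x z. b (c *\<^sub>C x) z = c * b x z) \<and>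
     (\<forall>x y z. b x (y + z) = b x y + b x z) \<and> (\<forall>c x z. b x (c *\<^sub>C z) = cnj c * b x z) \<and>
     (\<exists>K. \<forall>x y. cmod (b x y) \<le> K * norm x * norm y)"

text \<open>The real Riesz theorem applied to \<open>y \<mapsto> Re (b x y)\<close> already yields the complex
  representation: replacing \<open>y\<close> by \<open>\<i> *\<^sub>C y\<close> turns equality of real parts into
  equality of imaginary parts.\<close>

lemma bounded_sesquilinear_operator:
  fixes b :: "'a::complex_inner \<Rightarrow> 'b::chilbert_space \<Rightarrow> complex"
  assumes "bounded_sesquilinear b"
  shows "\<exists>A. bounded_clinear A \<and> (\<forall>x y. cinner (A x) y = b x y)"
proof -
  obtain K where addl: "\<And>x y z. b (x + y) z = b x z + b y z"
    and scl: "\<And>c x z. b (c *\<^sub>C x) z = c * b x z"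
    and addr: "\<And>x y z. b x (y + z) = b x y + b x z"
    and scr: "\<And>c x z. b x (c *\<^sub>C z) = cnj c * b x z"
    and K: "\<And>x y. cmod (b x y) \<le> K * norm x * norm y"
    using assms unfolding bounded_sesquilinear_def by blast
  have "\<exists>z. \<forall>y. cinner z y = b x y" for x
  proof -
    have "bounded_linear (\<lambda>y. Re (b x y))"
    proof (rule bounded_linear_intro)
      fix y z :: 'b and r :: real
      show "Re (b x (y + z)) = Re (b x y) + Re (b x z)" by (simp add: addr)
      show "Re (b x (r *\<^sub>R y)) = r *\<^sub>R Re (b x y)"
        using scr[of x "complex_of_real r" y] by (simp add: scaleC_of_real)
      show "norm (Re (b x y)) \<le> norm y * (K * norm x)"
        using K[of x y] abs_Re_le_cmod[of "b x y"] by (simp add: mult_ac)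
    qed
    then obtain z where z: "\<And>y. inner z y = Re (b x y)" using riesz_real by blast
    have "cinner z y = b x y" for y
    proof (rule complex_eqI)
      show "Re (cinner z y) = Re (b x y)" by (simp add: Re_cinner z)
      have "Re (cinner z (\<i> *\<^sub>C y)) = Re (b x (\<i> *\<^sub>C y))" by (simp add: Re_cinner z)
      then show "Im (cinner z y) = Im (b x y)" by (simp add: cinner_scaleC_right scr)
    qed
    then show ?thesis by blast
  qed
  then obtain A where A: "\<And>x y. cinner (A x) y = b x y" by metis
  have Asc: "A (c *\<^sub>C x) = c *\<^sub>C A x" for c x
    by (rule cinner_extensionality) (simp add: A cinner_scaleC_left scl)
  have "bounded_linear A"
  proof (rule bounded_linear_intro)
    fix x y :: 'a and r :: real
    show "A (x + y) = A x + A y"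
      by (rule cinner_extensionality) (simp add: A cinner_add_left addl)
    show "A (r *\<^sub>R x) = r *\<^sub>R A x" using Asc[of "complex_of_real r" x] by (simp add: scaleC_of_real)
    have "norm (A x) * norm (A x) = Re (b x (A x))"
      by (metis A Re_cinner power2_eq_square power2_norm_eq_inner)
    also have "\<dots> \<le> cmod (b x (A x))" by (rule complex_Re_le_cmod)
    also have "\<dots> \<le> K * norm x * norm (A x)" by (rule K)
    finally have "norm (A x) \<le> K * norm x \<or> norm (A x) = 0" by auto
    moreover have "0 \<le> \<bar>K\<bar> * norm x" "K * norm x \<le> \<bar>K\<bar> * norm x" by (auto intro: mult_right_mono)
    ultimately show "norm (A x) \<le> norm x * \<bar>K\<bar>" by (auto simp: mult.commute)
  qed
  then show ?thesis using A Asc unfolding bounded_clinear_def by blast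
qed

lemma bounded_clinear_adjoint:
  fixes T :: "'a::chilbert_space \<Rightarrow> 'b::complex_inner"
  assumes "bounded_clinear T"
  shows "\<exists>T'. \<forall>x y. cinner (T' x) y = cinner x (T y)"
proof -
  interpret T: bounded_linear T using assms unfolding bounded_clinear_def by blast
  obtain K where K: "\<And>x. norm (T x) \<le> norm x * K" using T.bounded by blast
  have "cmod (cinner x (T y)) \<le> K * norm x * norm y" for x y
    using cmod_cinner_le[of x "T y"] mult_left_mono[OF K[of y], of "norm x"] by (simp add: mult_ac)
  then have "bounded_sesquilinear (\<lambda>x y. cinner x (T y))"
    using assms unfolding bounded_sesquilinear_def bounded_clinear_def
    by (auto simp: cinner_add_left cinner_add_right cinner_scaleC_left cinner_scaleC_right T.add)
  then show ?thesis using bounded_sesquilinear_operator by blast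
qed

section \<open>Invariance of Haar measure on unimodular groups\<close>

lemma measurable_continuous_borel:
  fixes f :: "'g::topological_space \<Rightarrow> 'g"
  assumes "sets \<mu> = sets borel" "continuous_on UNIV f"
  shows "f \<in> measurable \<mu> \<mu>"
  using borel_measurable_continuous_onI[OF assms(2)] measurable_cong_sets[OF assms(1) assms(1)]
  by auto

lemma haar_sets: "left_haar_measure \<mu> \<Longrightarrow> sets \<mu> = sets borel"
  unfolding left_haar_measure_def by (elim conjE)

lemma haar_compact_finite: "left_haar_measure \<mu> \<Longrightarrow> compact K \<Longrightarrow> emeasure \<mu> K < \<infinity>"
  unfolding left_haar_measure_def by (elim conjE allE[of _ K] mp)

lemma vimage_add_left_eq_image: "(\<lambda>y. x + y) -` A = (\<lambda>y. - x + y) ` (A :: 'g::group_add set)"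
  by (rule set_eqI) (simp add: image_iff, metis add_minus_cancel minus_add_cancel)

lemma vimage_add_right_eq_image: "(\<lambda>y. y + x) -` A = (\<lambda>y. y + - x) ` (A :: 'g::group_add set)"
  by (rule set_eqI) (simp add: image_iff, metis add_diff_cancel diff_add_cancel)

lemma haar_left_invariant:
  fixes \<mu> :: "'g::topological_group_add measure"
  assumes "left_haar_measure \<mu>"
  shows "(\<lambda>y. x + y) \<in> measurable \<mu> \<mu>" "distr \<mu> \<mu> (\<lambda>y. x + y) = \<mu>"
proof -
  have s: "sets \<mu> = sets borel" using assms haar_sets by blast
  show m: "(\<lambda>y. x + y) \<in> measurable \<mu> \<mu>"
    by (intro measurable_continuous_borel s continuous_intros)
  have sp: "space \<mu> = UNIV" using sets_eq_imp_space_eq[OF s] by simp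
  show "distr \<mu> \<mu> (\<lambda>y. x + y) = \<mu>"
  proof (rule measure_eqI)
    fix A assume "A \<in> sets (distr \<mu> \<mu> (\<lambda>y. x + y))"
    then have A: "A \<in> sets \<mu>" by simp
    have "emeasure \<mu> ((\<lambda>y. - x + y) ` A) = emeasure \<mu> A"
      using assms A s unfolding left_haar_measure_def by metis
    then show "emeasure (distr \<mu> \<mu> (\<lambda>y. x + y)) A = emeasure \<mu> A"
      by (simp only: emeasure_distr[OF m A] sp Int_UNIV_right vimage_add_left_eq_image)
  qed simp
qed

lemma haar_right_invariant:
  fixes \<mu> :: "'g::topological_group_add measure"
  assumes "left_haar_measure \<mu>" "unimodular TYPE('g)"
  shows "(\<lambda>y. y + x) \<in> measurable \<mu> \<mu>" "distr \<mu> \<mu> (\<lambda>y. y + x) = \<mu>"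
proof -
  have s: "sets \<mu> = sets borel" using assms haar_sets by blast
  show m: "(\<lambda>y. y + x) \<in> measurable \<mu> \<mu>"
    by (intro measurable_continuous_borel s continuous_intros)
  have sp: "space \<mu> = UNIV" using sets_eq_imp_space_eq[OF s] by simp
  show "distr \<mu> \<mu> (\<lambda>y. y + x) = \<mu>"
  proof (rule measure_eqI)
    fix A assume "A \<in> sets (distr \<mu> \<mu> (\<lambda>y. y + x))"
    then have A: "A \<in> sets \<mu>" by simp
    have "emeasure \<mu> ((\<lambda>y. y + - x) ` A) = emeasure \<mu> A"
      using assms A s unfolding unimodular_def by metis
    then show "emeasure (distr \<mu> \<mu> (\<lambda>y. y + x)) A = emeasure \<mu> A"
      by (simp only: emeasure_distr[OF m A] sp Int_UNIV_right vimage_add_right_eq_image)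
  qed simp
qed

lemma countable_compact_cover:
  assumes "locally_compact_space (euclidean :: 'g::second_countable_topology topology)"
  obtains \<K> where "countable \<K>" "\<forall>K\<in>\<K>. compact K" "\<Union>\<K> = (UNIV :: 'g set)"
proof -
  have "\<forall>x::'g. \<exists>U K. open U \<and> compact K \<and> x \<in> U \<and> U \<subseteq> K"
    using assms unfolding locally_compact_space_def by auto
  then obtain U K where UK: "\<And>x::'g. open (U x) \<and> compact (K x) \<and> x \<in> U x \<and> U x \<subseteq> K x" by metis
  obtain F where F: "F \<subseteq> range U" "countable F" "\<Union>F = \<Union>(range U)"
    using Lindelof[of "range U"] UK by blast
  obtain X where X: "countable X" "F = U ` X" using F by (metis countable_subset_image)
  have "\<Union>(K ` X) = UNIV"
  proof -
    have "\<Union>(range U) = UNIV" using UK by blast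
    then have "\<Union>(U ` X) = UNIV" using F X by simp
    then show ?thesis using UK by blast
  qed
  then show ?thesis using X UK by (intro that[of "K ` X"]) auto
qed

lemma haar_sigma_finite:
  fixes \<mu> :: "'g::{topological_group_add,second_countable_topology,t2_space} measure"
  assumes "locally_compact_space (euclidean :: 'g topology)" "left_haar_measure \<mu>"
  shows "sigma_finite_measure \<mu>"
proof -
  obtain \<K> :: "'g set set" where K: "countable \<K>" "\<forall>K\<in>\<K>. compact K" "\<Union>\<K> = UNIV"
    by (rule countable_compact_cover[OF assms(1)])
  have s: "sets \<mu> = sets borel" using assms haar_sets by blast
  have sp: "space \<mu> = UNIV" using sets_eq_imp_space_eq[OF s] by simp
  have "K \<in> sets \<mu> \<and> emeasure \<mu> K \<noteq> \<infinity>" if "K \<in> \<K>" for K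
  proof -
    have "compact K" using that K(2) by blast
    then show ?thesis
      using haar_compact_finite[OF assms(2)] s by (simp add: compact_imp_closed less_imp_neq)
  qed
  then show ?thesis
    using K(1,3) sp by unfold_locales (intro exI[of _ \<K>], auto)
qed

lemma haar_compact_nonnull:
  fixes \<mu> :: "'g::{topological_group_add,second_countable_topology,t2_space} measure"
  assumes "locally_compact_space (euclidean :: 'g topology)" "left_haar_measure \<mu>"
  shows "\<exists>K. K \<in> sets \<mu> \<and> emeasure \<mu> K \<noteq> 0 \<and> emeasure \<mu> K < \<infinity>"
proof -
  obtain \<K> :: "'g set set" where K: "countable \<K>" "\<forall>K\<in>\<K>. compact K" "\<Union>\<K> = UNIV"
    by (rule countable_compact_cover[OF assms(1)])
  have s: "sets \<mu> = sets borel" using assms haar_sets by blast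
  have KS: "K \<in> sets \<mu>" if "K \<in> \<K>" for K using K that s by (auto simp: compact_imp_closed)
  have "\<exists>K\<in>\<K>. emeasure \<mu> K \<noteq> 0"
  proof (rule ccontr)
    assume "\<not> ?thesis"
    then have "(\<Union>K\<in>\<K>. K) \<in> null_sets \<mu>" using K(1) KS by (intro null_sets_UN') auto
    then have "emeasure \<mu> UNIV = 0" using K(3) by auto
    then show False using assms(2) unfolding left_haar_measure_def by (elim conjE notE)
  qed
  then show ?thesis using K(2) KS haar_compact_finite[OF assms(2)] by blast
qed

lemma nn_integral_preserved:
  fixes f :: "'a \<Rightarrow> ennreal"
  assumes "h \<in> measurable M M" "distr M M h = M" "f \<in> borel_measurable M"
  shows "(\<integral>\<^sup>+x. f (h x) \<partial>M) = (\<integral>\<^sup>+x. f x \<partial>M)"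
  using nn_integral_distr[of h M M f] assms by simp

lemma integral_preserved:
  fixes f :: "'a \<Rightarrow> 'b::{banach,second_countable_topology}"
  assumes "h \<in> measurable M M" "distr M M h = M" "f \<in> borel_measurable M"
  shows "(LINT x|M. f (h x)) = (LINT x|M. f x)"
    and "integrable M (\<lambda>x. f (h x)) \<longleftrightarrow> integrable M f"
  using integral_distr[of h M M f] integrable_distr_eq[of h M M f] assms by simp_all

text \<open>For a measure that is invariant on both sides,
  \<open>\<integral>\<integral> f x g (y + x) dx dy\<close> can be evaluated in two ways. Integrating over \<open>y\<close> first gives
  \<open>(\<integral> f) (\<integral> g)\<close>; substituting \<open>- y + x\<close> for \<open>x\<close> and then \<open>x + y\<close> for \<open>y\<close> gives
  \<open>(\<integral> f (- y) dy) (\<integral> g)\<close>. Cancelling a factor \<open>\<integral> g\<close> that is positive and finite proves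
  invariance under inversion, without appeal to uniqueness of Haar measure.\<close>

lemma haar_inversion_invariant:
  fixes \<mu> :: "'g::{topological_group_add,second_countable_topology,t2_space} measure"
  assumes lc: "locally_compact_space (euclidean :: 'g topology)"
    and haar: "left_haar_measure \<mu>" and uni: "unimodular TYPE('g)"
  shows "uminus \<in> measurable \<mu> \<mu>" "distr \<mu> \<mu> uminus = \<mu>"
proof -
  interpret sigma_finite_measure \<mu> using haar_sigma_finite[OF lc haar] .
  interpret P: pair_sigma_finite \<mu> \<mu> ..
  have s: "sets \<mu> = sets borel" using haar by (rule haar_sets)
  have [simp]: "space \<mu> = UNIV" using sets_eq_imp_space_eq[OF s] by simp
  show minus [measurable]: "uminus \<in> measurable \<mu> \<mu>"
    by (intro measurable_continuous_borel s continuous_intros)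
  have "(\<lambda>p. fst p + snd p) \<in> measurable (borel \<Otimes>\<^sub>M borel) (borel :: 'g measure)"
    unfolding borel_prod by (intro borel_measurable_continuous_onI continuous_intros)
  then have plus: "(\<lambda>p. fst p + snd p) \<in> measurable (\<mu> \<Otimes>\<^sub>M \<mu>) \<mu>"
    using measurable_cong_sets[OF sets_pair_measure_cong[OF s s] s] by blast
  have plus' [measurable (raw)]: "(\<lambda>w. f w + g w) \<in> measurable N \<mu>"
    if "f \<in> measurable N \<mu>" "g \<in> measurable N \<mu>" for f g and N :: "'z measure"
    using measurable_compose[OF measurable_Pair[OF that] plus] by simp
  obtain K where K: "K \<in> sets \<mu>" "emeasure \<mu> K \<noteq> 0" "emeasure \<mu> K < \<infinity>"
    using haar_compact_nonnull[OF lc haar] by blast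
  have left: "(\<integral>\<^sup>+y. f (x + y) \<partial>\<mu>) = (\<integral>\<^sup>+y. f y \<partial>\<mu>)"
    if "f \<in> borel_measurable \<mu>" for f :: "'g \<Rightarrow> ennreal" and x
    by (rule nn_integral_preserved[OF haar_left_invariant[OF haar] that])
  have right: "(\<integral>\<^sup>+y. f (y + x) \<partial>\<mu>) = (\<integral>\<^sup>+y. f y \<partial>\<mu>)"
    if "f \<in> borel_measurable \<mu>" for f :: "'g \<Rightarrow> ennreal" and x
    by (rule nn_integral_preserved[OF haar_right_invariant[OF haar uni] that])
  show "distr \<mu> \<mu> uminus = \<mu>"
  proof (rule measure_eqI)
    fix A assume "A \<in> sets (distr \<mu> \<mu> uminus)"
    then have A: "A \<in> sets \<mu>" by simp
    define f g :: "'g \<Rightarrow> ennreal" where "f = indicator A" and "g = indicator K"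
    have [measurable]: "f \<in> borel_measurable \<mu>" "g \<in> borel_measurable \<mu>"
      using A K by (auto simp: f_def g_def)
    have "(\<integral>\<^sup>+x. f x \<partial>\<mu>) * (\<integral>\<^sup>+y. g y \<partial>\<mu>) = (\<integral>\<^sup>+x. f x * (\<integral>\<^sup>+y. g (y + x) \<partial>\<mu>) \<partial>\<mu>)"
      by (simp add: right nn_integral_multc)
    also have "\<dots> = (\<integral>\<^sup>+x. (\<integral>\<^sup>+y. f x * g (y + x) \<partial>\<mu>) \<partial>\<mu>)"
      by (intro nn_integral_cong nn_integral_cmult[symmetric]) simp
    also have "\<dots> = (\<integral>\<^sup>+y. (\<integral>\<^sup>+x. f x * g (y + x) \<partial>\<mu>) \<partial>\<mu>)"
      by (rule P.Fubini'[symmetric]) simp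
    also have "\<dots> = (\<integral>\<^sup>+y. (\<integral>\<^sup>+x. f (- y + x) * g x \<partial>\<mu>) \<partial>\<mu>)"
    proof (rule nn_integral_cong)
      fix y
      have "(\<lambda>x. f (- y + x) * g x) \<in> borel_measurable \<mu>" by measurable
      from left[OF this, of y]
      show "(\<integral>\<^sup>+x. f x * g (y + x) \<partial>\<mu>) = (\<integral>\<^sup>+x. f (- y + x) * g x \<partial>\<mu>)"
        by simp
    qed
    also have "\<dots> = (\<integral>\<^sup>+x. (\<integral>\<^sup>+y. f (- y + x) * g x \<partial>\<mu>) \<partial>\<mu>)"
      by (rule P.Fubini') simp
    also have "\<dots> = (\<integral>\<^sup>+x. (\<integral>\<^sup>+y. f (- y + x) \<partial>\<mu>) * g x \<partial>\<mu>)"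
      by (intro nn_integral_cong nn_integral_multc) simp
    also have "\<dots> = (\<integral>\<^sup>+x. (\<integral>\<^sup>+y. f (- y) \<partial>\<mu>) * g x \<partial>\<mu>)"
    proof (rule nn_integral_cong)
      fix x
      show "(\<integral>\<^sup>+y. f (- y + x) \<partial>\<mu>) * g x = (\<integral>\<^sup>+y. f (- y) \<partial>\<mu>) * g x"
        using left[of "\<lambda>y. f (- y)" "- x"] by (simp add: minus_add)
    qed
    also have "\<dots> = (\<integral>\<^sup>+y. f (- y) \<partial>\<mu>) * (\<integral>\<^sup>+x. g x \<partial>\<mu>)"
      by (intro nn_integral_cmult) simp
    finally have "emeasure \<mu> K * emeasure \<mu> A = emeasure \<mu> K * (\<integral>\<^sup>+y. f (- y) \<partial>\<mu>)"
      using A K(1) by (simp add: f_def g_def mult.commute)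
    then have "emeasure \<mu> A = (\<integral>\<^sup>+y. f (- y) \<partial>\<mu>)"
      using K(2,3) by (auto simp: ennreal_mult_cancel_left)
    also have "\<dots> = emeasure (distr \<mu> \<mu> uminus) A"
      using nn_integral_distr[of uminus \<mu> \<mu> f] A
      by (simp add: f_def)
    finally show "emeasure (distr \<mu> \<mu> uminus) A = emeasure \<mu> A" by simp
  qed simp
qed

section \<open>Square-integrable functions\<close>

lemma borel_measurable_cnj [measurable (raw)]:
  assumes "f \<in> borel_measurable M"
  shows "(\<lambda>x. cnj (f x)) \<in> borel_measurable M"
  using assms by (rule borel_measurable_continuous_on[rotated]) (intro continuous_intros)

text \<open>The Cauchy-Schwarz inequality, with \<open>p\<close> and \<open>q\<close> as positive upper bounds of the norms: the
  integrand is at most \<open>(q / p * cmod (f x)\<^sup>2 + p / q * cmod (g x)\<^sup>2) / 2\<close> pointwise.\<close>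

lemma L2_inner_bound:
  assumes f: "f \<in> L2 \<mu>" and g: "g \<in> L2 \<mu>"
    and p: "L2_norm \<mu> f \<le> p" "0 < p" and q: "L2_norm \<mu> g \<le> q" "0 < q"
  shows "integrable \<mu> (\<lambda>x. f x * cnj (g x))" and "cmod (L2_inner \<mu> f g) \<le> p * q"
proof -
  have [measurable]: "f \<in> borel_measurable \<mu>" "g \<in> borel_measurable \<mu>"
    and i: "integrable \<mu> (\<lambda>x. (cmod (f x))\<^sup>2)" "integrable \<mu> (\<lambda>x. (cmod (g x))\<^sup>2)"
    using f g by (auto simp: L2_def)
  define h where "h x = (q / p * (cmod (f x))\<^sup>2 + p / q * (cmod (g x))\<^sup>2) / 2" for x
  have ih: "integrable \<mu> h" unfolding h_def using i by simp
  have le: "cmod (f x * cnj (g x)) \<le> h x" for x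
  proof -
    have "0 \<le> (q * cmod (f x) - p * cmod (g x))\<^sup>2" by simp
    then have "cmod (f x) * cmod (g x) * (2 * (p * q)) \<le> (q * cmod (f x))\<^sup>2 + (p * cmod (g x))\<^sup>2"
      by (simp add: power2_diff algebra_simps)
    also have "\<dots> = h x * (2 * (p * q))"
      using p(2) q(2) by (simp add: h_def field_simps power2_eq_square)
    finally show ?thesis using p(2) q(2) by (simp add: norm_mult)
  qed
  show int: "integrable \<mu> (\<lambda>x. f x * cnj (g x))"
  proof (rule Bochner_Integration.integrable_bound[OF ih])
    show "(\<lambda>x. f x * cnj (g x)) \<in> borel_measurable \<mu>" by measurable
    show "AE x in \<mu>. norm (f x * cnj (g x)) \<le> norm (h x)"
      using order_trans[OF le abs_ge_self] by (simp only: real_norm_def eventually_True)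
  qed
  have sq: "(LINT x|\<mu>. (cmod (f x))\<^sup>2) \<le> p\<^sup>2" "(LINT x|\<mu>. (cmod (g x))\<^sup>2) \<le> q\<^sup>2"
    using p q by (auto simp: L2_norm_def intro: sqrt_le_D)
  have "cmod (L2_inner \<mu> f g) \<le> (LINT x|\<mu>. cmod (f x * cnj (g x)))"
    unfolding L2_inner_def by (rule integral_norm_bound)
  also have "\<dots> \<le> (LINT x|\<mu>. h x)"
    by (rule integral_mono[OF integrable_norm[OF int] ih le])
  also have "\<dots> = (q / p * (LINT x|\<mu>. (cmod (f x))\<^sup>2) + p / q * (LINT x|\<mu>. (cmod (g x))\<^sup>2)) / 2"
    unfolding h_def using i by simp
  also have "\<dots> \<le> (q / p * p\<^sup>2 + p / q * q\<^sup>2) / 2"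
    using sq p(2) q(2) by (intro divide_right_mono add_mono mult_left_mono) auto
  also have "\<dots> = p * q" using p(2) q(2) by (simp add: power2_eq_square)
  finally show "cmod (L2_inner \<mu> f g) \<le> p * q" .
qed

lemma L2_inner_integrable:
  assumes "f \<in> L2 \<mu>" "g \<in> L2 \<mu>"
  shows "integrable \<mu> (\<lambda>x. f x * cnj (g x))"
proof (rule L2_inner_bound(1)[OF assms])
  show "L2_norm \<mu> f \<le> \<bar>L2_norm \<mu> f\<bar> + 1" "L2_norm \<mu> g \<le> \<bar>L2_norm \<mu> g\<bar> + 1" by auto
qed auto

lemma L2_inner_cnj: "cnj (L2_inner \<mu> f g) = L2_inner \<mu> g f"
  unfolding L2_inner_def by (simp flip: Bochner_Integration.integral_cnj add: mult.commute)

lemma bounded_linear_cinner_right: "bounded_linear (\<lambda>y. cinner x (y :: 'a::complex_inner))"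
proof (rule bounded_linear_intro)
  fix y z :: 'a and r :: real
  show "cinner x (y + z) = cinner x y + cinner x z" by (rule cinner_add_right)
  show "cinner x (r *\<^sub>R y) = r *\<^sub>R cinner x y"
    using cinner_scaleC_right[of x "complex_of_real r" y]
    by (simp add: scaleC_of_real scaleR_conv_of_real)
  show "norm (cinner x y) \<le> norm y * norm x"
    using cmod_cinner_le[of x y] by (simp add: mult.commute)
qed

section \<open>Coefficient operators of a unitary representation\<close>

lemma coeff_op_add: "coeff_op \<pi> \<eta> (u + v) x = coeff_op \<pi> \<eta> u x + coeff_op \<pi> \<eta> v x"
  by (simp add: coeff_op_def cinner_add_left)

lemma coeff_op_scaleC: "coeff_op \<pi> \<eta> (c *\<^sub>C u) x = c * coeff_op \<pi> \<eta> u x"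
  by (simp add: coeff_op_def cinner_scaleC_left)

lemma bounded_vector_L2: "bounded_vector \<mu> \<pi> \<eta> \<Longrightarrow> coeff_op \<pi> \<eta> u \<in> L2 \<mu>"
  unfolding bounded_vector_def bounded_into_L2_def by blast

lemma bounded_vector_bound:
  assumes "bounded_vector \<mu> \<pi> \<eta>"
  obtains C where "C > 0" "\<forall>u. L2_norm \<mu> (coeff_op \<pi> \<eta> u) \<le> C * norm u"
proof -
  obtain C where C: "\<And>u. L2_norm \<mu> (coeff_op \<pi> \<eta> u) \<le> C * norm u"
    using assms unfolding bounded_vector_def bounded_into_L2_def by blast
  have "L2_norm \<mu> (coeff_op \<pi> \<eta> u) \<le> (\<bar>C\<bar> + 1) * norm u" for u
  proof -
    have "C * norm u \<le> (\<bar>C\<bar> + 1) * norm u" by (rule mult_right_mono) auto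
    then show ?thesis using C[of u] by linarith
  qed
  then show ?thesis by (intro that[of "\<bar>C\<bar> + 1"]) auto
qed

lemma bounded_sesquilinear_coeff:
  assumes psi: "bounded_vector \<mu> \<pi> \<psi>" and eta: "bounded_vector \<mu> \<pi> \<eta>"
  shows "bounded_sesquilinear (\<lambda>u w. L2_inner \<mu> (coeff_op \<pi> \<psi> u) (coeff_op \<pi> \<eta> w))"
proof -
  note int = L2_inner_integrable[OF bounded_vector_L2[OF psi] bounded_vector_L2[OF eta]]
  obtain C where C: "C > 0" "\<forall>u. L2_norm \<mu> (coeff_op \<pi> \<psi> u) \<le> C * norm u"
    by (rule bounded_vector_bound[OF psi])
  obtain D where D: "D > 0" "\<forall>u. L2_norm \<mu> (coeff_op \<pi> \<eta> u) \<le> D * norm u"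
    by (rule bounded_vector_bound[OF eta])
  have "cmod (L2_inner \<mu> (coeff_op \<pi> \<psi> u) (coeff_op \<pi> \<eta> w)) \<le> (C * D) * norm u * norm w" for u w
  proof (cases "u = 0 \<or> w = 0")
    case True
    then show ?thesis by (auto simp: L2_inner_def coeff_op_def)
  next
    case False
    then have "cmod (L2_inner \<mu> (coeff_op \<pi> \<psi> u) (coeff_op \<pi> \<eta> w)) \<le> (C * norm u) * (D * norm w)"
      using C D by (intro L2_inner_bound(2) bounded_vector_L2 psi eta) auto
    then show ?thesis by (simp add: mult_ac)
  qed
  then have "\<exists>K. \<forall>u w. cmod (L2_inner \<mu> (coeff_op \<pi> \<psi> u) (coeff_op \<pi> \<eta> w)) \<le> K * norm u * norm w"
    by blast
  then show ?thesis
    unfolding bounded_sesquilinear_def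
    by (auto simp: L2_inner_def coeff_op_add coeff_op_scaleC distrib_left distrib_right int mult.assoc
        mult.left_commute[of _ "cnj _"])
qed

locale unimodular_rep =
  fixes \<mu> :: "'g::{topological_group_add, second_countable_topology, t2_space} measure"
    and \<pi> :: "'g \<Rightarrow> 'h \<Rightarrow> 'h::chilbert_space"
  assumes locally_compact: "locally_compact_space (euclidean :: 'g topology)"
    and unimodular: "unimodular TYPE('g)"
    and haar: "left_haar_measure \<mu>"
    and rep: "unitary_rep \<pi>"
begin

abbreviation V :: "'h \<Rightarrow> 'h \<Rightarrow> 'g \<Rightarrow> complex" where "V \<equiv> coeff_op \<pi>"

lemma rep_add: "\<pi> (x + y) v = \<pi> x (\<pi> y v)"
  using rep unfolding unitary_rep_def by simp

lemma rep_zero: "\<pi> 0 v = v"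
  using rep unfolding unitary_rep_def by simp

lemma cinner_rep: "cinner (\<pi> x u) (\<pi> x v) = cinner u v"
  using rep unfolding unitary_rep_def unitary_def by blast

lemma cinner_rep_left: "cinner (\<pi> x u) v = cinner u (\<pi> (- x) v)"
  using cinner_rep[of "- x" "\<pi> x u" v] by (simp add: rep_add[symmetric] rep_zero)

lemma coeff_measurable [measurable]: "V \<eta> u \<in> borel_measurable \<mu>"
proof -
  have "continuous_on UNIV (\<lambda>x. \<pi> x \<eta>)" using rep unfolding unitary_rep_def by blast
  then have "continuous_on UNIV (V \<eta> u)"
    unfolding coeff_op_def by (rule bounded_linear.continuous_on[OF bounded_linear_cinner_right])
  then show ?thesis
    using borel_measurable_continuous_onI measurable_cong_sets[OF haar_sets[OF haar] refl] by blast
qed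

lemma coeff_rep_left: "V \<eta> (\<pi> y u) x = V \<eta> u (- y + x)"
  by (simp add: coeff_op_def cinner_rep_left rep_add)

lemma coeff_rep_right: "V (\<pi> y \<eta>) u x = V \<eta> u (x + y)"
  by (simp add: coeff_op_def rep_add)

text \<open>Substitute \<open>- x\<close> for \<open>x\<close>: inversion exchanges the two arguments of a coefficient up to
  conjugation, \<open>V \<eta> u (- x) = cnj (V u \<eta> x)\<close>. The Bochner integral is \<open>0\<close>
  off its domain, so the identity also covers products that are not integrable.\<close>

lemma L2_inner_coeff_swap:
  "L2_inner \<mu> (V \<psi> u) (V \<eta> v) = L2_inner \<mu> (V v \<eta>) (V u \<psi>)"
proof -
  have inv: "V \<eta> u (- x) = cnj (V u \<eta> x)" for \<eta> u x
    unfolding coeff_op_def by (metis cinner_rep_left cinner_commute)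
  have "(\<lambda>x. V \<psi> u x * cnj (V \<eta> v x)) \<in> borel_measurable \<mu>" by measurable
  from integral_preserved(1)[OF haar_inversion_invariant[OF locally_compact haar unimodular] this]
  show ?thesis unfolding L2_inner_def by (simp add: inv mult.commute)
qed

lemma L2_inner_coeff_rep:
  "L2_inner \<mu> (V \<psi> (\<pi> y u)) (V \<eta> (\<pi> y v)) = L2_inner \<mu> (V \<psi> u) (V \<eta> v)"
proof -
  have "(\<lambda>x. V \<psi> u x * cnj (V \<eta> v x)) \<in> borel_measurable \<mu>" by measurable
  from integral_preserved(1)[OF haar_left_invariant[OF haar] this, of "- y"]
  show ?thesis unfolding L2_inner_def by (simp add: coeff_rep_left)
qed

text \<open>Moving \<open>\<eta>\<close> along its orbit translates its coefficients on the right, which preserves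
  \<open>L\<^sup>2\<close>-norms by unimodularity.\<close>

lemma bounded_vector_rep:
  assumes "bounded_vector \<mu> \<pi> \<eta>"
  shows "bounded_vector \<mu> \<pi> (\<pi> y \<eta>)"
proof -
  have "(\<lambda>x. (cmod (V \<eta> u x))\<^sup>2) \<in> borel_measurable \<mu>" for u by measurable
  note pres = integral_preserved[OF haar_right_invariant[OF haar unimodular] this]
  have "V (\<pi> y \<eta>) u \<in> L2 \<mu>" for u
    using bounded_vector_L2[OF assms, of u] pres(2)
    unfolding L2_def by (simp add: coeff_rep_right)
  moreover have "L2_norm \<mu> (V (\<pi> y \<eta>) u) = L2_norm \<mu> (V \<eta> u)" for u
    unfolding L2_norm_def coeff_rep_right using pres(1) by simp
  ultimately show ?thesis
    using assms unfolding bounded_vector_def bounded_into_L2_def by simp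
qed

text \<open>The operator \<open>A\<close> is \<open>V\<^sub>\<eta>\<^sup>* V\<^sub>\<psi>\<close>; it intertwines \<open>\<pi>\<close> with itself because
  coefficient operators intertwine \<open>\<pi>\<close> with left translation.\<close>

lemma coeff_operator_commutant:
  assumes "bounded_vector \<mu> \<pi> \<psi>" "bounded_vector \<mu> \<pi> \<eta>"
  obtains A where "A \<in> commutant \<pi>"
    and "\<forall>u w. cinner (A u) w = L2_inner \<mu> (V \<psi> u) (V \<eta> w)"
proof -
  obtain A where A: "bounded_clinear A"
    and eq: "\<And>u w. cinner (A u) w = L2_inner \<mu> (V \<psi> u) (V \<eta> w)"
    using bounded_sesquilinear_operator[OF bounded_sesquilinear_coeff[OF assms]] by blast
  have "A (\<pi> y u) = \<pi> y (A u)" for y u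
  proof (rule cinner_extensionality)
    fix w
    have "cinner (A (\<pi> y u)) w = L2_inner \<mu> (V \<psi> (\<pi> y u)) (V \<eta> (\<pi> y (\<pi> (- y) w)))"
      by (simp add: eq rep_add[symmetric] rep_zero)
    also have "\<dots> = cinner (\<pi> y (A u)) w"
      by (simp only: L2_inner_coeff_rep cinner_rep_left eq)
    finally show "cinner (A (\<pi> y u)) w = cinner (\<pi> y (A u)) w" .
  qed
  then have "A \<in> commutant \<pi>" using A unfolding commutant_def by (auto simp: fun_eq_iff)
  then show ?thesis using eq that by blast
qed

text \<open>The definite description in \<^const>\<open>L2_adjoint\<close> is met by the vector that
  the operator of the preceding lemma produces; this frees admissibility of adjoints.\<close>

lemma admissible_iff:
  "admissible \<mu> \<pi> \<eta> \<psi> \<longleftrightarrow> bounded_vector \<mu> \<pi> \<eta> \<and> bounded_vector \<mu> \<pi> \<psi> \<and>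
     (\<forall>u w. L2_inner \<mu> (V \<psi> u) (V \<eta> w) = cinner u w)"
proof (cases "bounded_vector \<mu> \<pi> \<eta> \<and> bounded_vector \<mu> \<pi> \<psi>")
  case True
  then obtain A where A: "\<forall>u w. cinner (A u) w = L2_inner \<mu> (V \<psi> u) (V \<eta> w)"
    using coeff_operator_commutant by metis
  have adj: "L2_adjoint \<mu> (V \<eta>) (V \<psi> u) = A u" for u
    unfolding L2_adjoint_def
  proof (rule the_equality)
    show "\<forall>w. cinner (A u) w = L2_inner \<mu> (V \<psi> u) (V \<eta> w)" using A by blast
    show "v = A u" if "\<forall>w. cinner v w = L2_inner \<mu> (V \<psi> u) (V \<eta> w)" for v
      by (rule cinner_extensionality) (simp add: that A)
  qed
  have "(\<forall>u. A u = u) \<longleftrightarrow> (\<forall>u w. cinner (A u) w = cinner u w)"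
    using cinner_extensionality by metis
  then show ?thesis
    using True A unfolding admissible_def by (auto simp: fun_eq_iff adj)
qed (auto simp: admissible_def)

text \<open>Vectors orthogonal to the orbit of \<open>\<eta>\<close> are annihilated by \<open>V\<^sub>\<eta>\<close>, which has the left inverse
  \<open>V\<^sub>\<psi>\<^sup>*\<close>. Stating totality in this form avoids approximation by linear combinations.\<close>

lemma admissible_cyclic:
  assumes "admissible \<mu> \<pi> \<eta> \<psi>" and orth: "\<And>x. cinner z (\<pi> x \<eta>) = 0"
  shows "z = 0"
proof (rule cinner_extensionality)
  fix w
  have "cinner w z = L2_inner \<mu> (V \<psi> w) (V \<eta> z)" using assms(1) by (simp add: admissible_iff)
  also have "\<dots> = 0" by (simp add: L2_inner_def coeff_op_def[of _ \<eta>] orth)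
  finally show "cinner z w = cinner 0 w" by (metis cinner_commute cinner_zero_left complex_cnj_zero)
qed

text \<open>Both admissibility relations are used once: that of \<open>(\<eta>\<^sub>0, \<psi>\<^sub>0)\<close> turns \<open>\<langle>T \<eta>, \<psi>\<rangle>\<close> into an inner
  product of coefficients, which the swap rearranges into one that the relation for \<open>(\<eta>, \<psi>)\<close>
  evaluates. The identity \<open>V\<^bsub>T \<eta>\<^esub> = V\<^sub>\<eta> T\<^sup>*\<close> carries \<open>T\<close> across.\<close>

lemma admissible_cinner_commutant:
  assumes adm: "admissible \<mu> \<pi> \<eta> \<psi>" and adm0: "admissible \<mu> \<pi> \<eta>\<^sub>0 \<psi>\<^sub>0"
    and T: "T \<in> commutant \<pi>"
  shows "cinner (T \<eta>) \<psi> = cinner (T \<eta>\<^sub>0) \<psi>\<^sub>0"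
proof -
  obtain T' where T': "\<And>u v. cinner (T' u) v = cinner u (T v)"
    using bounded_clinear_adjoint[of T] T unfolding commutant_def by blast
  have "V (T \<eta>) u = V \<eta> (T' u)" for u
    using T by (auto simp: fun_eq_iff coeff_op_def T' commutant_def)
  then have "cinner (T \<eta>) \<psi> = L2_inner \<mu> (V \<psi> \<eta>\<^sub>0) (V \<eta> (T' \<psi>\<^sub>0))"
    using adm0 by (metis admissible_iff L2_inner_coeff_swap)
  also have "\<dots> = cinner \<eta>\<^sub>0 (T' \<psi>\<^sub>0)" using adm by (simp add: admissible_iff)
  also have "\<dots> = cinner (T \<eta>\<^sub>0) \<psi>\<^sub>0" by (metis T' cinner_commute)
  finally show ?thesis .
qed

text \<open>For bounded \<open>u\<close> and \<open>v\<close> the swap expresses \<open>\<langle>V\<^sub>\<eta>\<^sup>* V\<^sub>\<psi> u, v\<rangle>\<close> through the element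
  \<open>V\<^sub>u\<^sup>* V\<^sub>v\<close> of the commutant, so the hypothesis gives \<open>\<langle>V\<^sub>\<eta>\<^sup>* V\<^sub>\<psi> u, v\<rangle> = \<langle>u, v\<rangle>\<close>. Applied to \<open>u\<close>, \<open>v\<close> in
  the orbit of \<open>\<eta>\<^sub>0\<close>, this suffices since that orbit is total.\<close>

lemma admissibleI_commutant:
  assumes eta: "bounded_vector \<mu> \<pi> \<eta>" and psi: "bounded_vector \<mu> \<pi> \<psi>"
    and adm0: "admissible \<mu> \<pi> \<eta>\<^sub>0 \<psi>\<^sub>0"
    and eq: "\<And>T. T \<in> commutant \<pi> \<Longrightarrow> cinner (T \<eta>) \<psi> = cinner (T \<eta>\<^sub>0) \<psi>\<^sub>0"
  shows "admissible \<mu> \<pi> \<eta> \<psi>"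
proof -
  have weak: "L2_inner \<mu> (V \<psi> u) (V \<eta> v) = cinner u v"
    if u: "bounded_vector \<mu> \<pi> u" and v: "bounded_vector \<mu> \<pi> v" for u v
  proof -
    obtain S where S: "S \<in> commutant \<pi>" "\<forall>p w. cinner (S p) w = L2_inner \<mu> (V v p) (V u w)"
      by (rule coeff_operator_commutant[OF v u])
    have "L2_inner \<mu> (V \<psi> u) (V \<eta> v) = cinner (S \<eta>) \<psi>" by (simp add: L2_inner_coeff_swap S(2))
    also have "\<dots> = cinner (S \<eta>\<^sub>0) \<psi>\<^sub>0" by (rule eq[OF S(1)])
    also have "\<dots> = L2_inner \<mu> (V \<psi>\<^sub>0 u) (V \<eta>\<^sub>0 v)"
      by (simp add: L2_inner_coeff_swap[of \<psi>\<^sub>0 u] S(2))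
    also have "\<dots> = cinner u v" using adm0 by (simp add: admissible_iff)
    finally show ?thesis .
  qed
  have orbit: "bounded_vector \<mu> \<pi> (\<pi> x \<eta>\<^sub>0)" for x
    using adm0 by (intro bounded_vector_rep) (simp add: admissible_iff)
  obtain A where A: "\<forall>u w. cinner (A u) w = L2_inner \<mu> (V \<psi> u) (V \<eta> w)"
    by (rule coeff_operator_commutant[OF psi eta])
  obtain A' where A': "\<forall>u w. cinner (A' u) w = L2_inner \<mu> (V \<eta> u) (V \<psi> w)"
    by (rule coeff_operator_commutant[OF eta psi])
  have "A (\<pi> y \<eta>\<^sub>0) - \<pi> y \<eta>\<^sub>0 = 0" for y
    by (rule admissible_cyclic[OF adm0]) (simp add: cinner_diff_left A weak orbit)
  then have fix_orbit: "A (\<pi> y \<eta>\<^sub>0) = \<pi> y \<eta>\<^sub>0" for y by simp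
  have adjoint: "cinner (A' w) u = cnj (cinner (A u) w)" for u w
    by (simp add: A A' L2_inner_cnj)
  \<comment> \<open>\<open>A\<close> is known on the orbit only, so the identity is read off from the adjoint \<open>A'\<close>\<close>
  have "A' w - w = 0" for w
    by (rule admissible_cyclic[OF adm0])
      (simp add: cinner_diff_left adjoint fix_orbit cinner_commute[of w, symmetric])
  then have "cinner (A' w) u = cinner w u" for u w by simp
  then have "L2_inner \<mu> (V \<psi> u) (V \<eta> w) = cinner u w" for u w
    by (metis A adjoint cinner_commute complex_cnj_cnj)
  then show ?thesis using eta psi by (simp add: admissible_iff)
qed

end

text \<open>Matrix coefficients of operators are weakly continuous and linear in the operator, so an
  equality of two of them passes from the \<open>T i\<close> to their span and on to its closure.\<close>

lemma wot_dense_cinner_eq: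
  fixes T :: "'i \<Rightarrow> 'h \<Rightarrow> 'h::complex_inner"
  assumes dense: "wot_dense_in (op_span T I) \<A>"
    and eq: "\<forall>i\<in>I. cinner (T i y) z = cinner (T i y') z'" and S: "S \<in> \<A>"
  shows "cinner (S y) z = cinner (S y') z'"
proof -
  have span: "cinner (R y) z = cinner (R y') z'" if "R \<in> op_span T I" for R
  proof -
    obtain J c where "R = (\<lambda>v. \<Sum>i\<in>J. c i *\<^sub>C T i v)" "J \<subseteq> I"
      using \<open>R \<in> op_span T I\<close> unfolding op_span_def by blast
    then show ?thesis
      using eq by (auto simp: cinner_sum_left cinner_scaleC_left intro!: sum.cong)
  qed
  obtain F where F: "F \<noteq> bot" "\<forall>\<^sub>F R in F. R \<in> op_span T I"
    and lim: "\<And>y z. ((\<lambda>R. cinner (R y) z) \<longlongrightarrow> cinner (S y) z) F"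
    using dense S unfolding wot_dense_in_def by blast
  have "\<forall>\<^sub>F R in F. cinner (R y) z = cinner (R y') z'"
    using F(2) by (rule eventually_mono) (rule span)
  then have "((\<lambda>R. cinner (R y') z') \<longlongrightarrow> cinner (S y) z) F"
    using lim[of y z] tendsto_cong by fastforce
  then show ?thesis using F(1) lim[of y' z'] tendsto_unique by blast
qed

theorem mainTheorem4:
  fixes \<mu> :: "'g::{topological_group_add, second_countable_topology, t2_space} measure"
    and \<pi> :: "'g \<Rightarrow> 'h \<Rightarrow> 'h::chilbert_space"
    and T :: "'i \<Rightarrow> 'h \<Rightarrow> 'h" and I :: "'i set"
    and \<eta>\<^sub>0 \<psi>\<^sub>0 \<eta> \<psi> :: 'h
  assumes "locally_compact_space (euclidean :: 'g topology)"
    and "unimodular TYPE('g)"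
    and "left_haar_measure \<mu>"
    and "unitary_rep \<pi>"
    and "\<forall>i\<in>I. T i \<in> commutant \<pi>"
    and "wot_dense_in (op_span T I) (commutant \<pi>)"
    and "admissible \<mu> \<pi> \<eta>\<^sub>0 \<psi>\<^sub>0"
    and "bounded_vector \<mu> \<pi> \<eta>" and "bounded_vector \<mu> \<pi> \<psi>"
  shows "admissible \<mu> \<pi> \<eta> \<psi> \<longleftrightarrow> (\<forall>i\<in>I. cinner (T i \<eta>) \<psi> = cinner (T i \<eta>\<^sub>0) \<psi>\<^sub>0)"
proof -
  interpret unimodular_rep \<mu> \<pi> using assms(1-4) by unfold_locales
  show ?thesis
  proof
    assume "admissible \<mu> \<pi> \<eta> \<psi>"
    then show "\<forall>i\<in>I. cinner (T i \<eta>) \<psi> = cinner (T i \<eta>\<^sub>0) \<psi>\<^sub>0"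
      using admissible_cinner_commutant assms(5,7) by blast
  next
    assume "\<forall>i\<in>I. cinner (T i \<eta>) \<psi> = cinner (T i \<eta>\<^sub>0) \<psi>\<^sub>0"
    then show "admissible \<mu> \<pi> \<eta> \<psi>"
      by (intro admissibleI_commutant[OF assms(8,9,7)] wot_dense_cinner_eq[OF assms(6)])
  qed
qed

end
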